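(* For every integer $n\ge 5$, with $F_n=2^{2^n}+1$, $$3^{(F_n-1)/4}\not\equiv -1 \pmod{F_n}.$$
   Context: For an integer $n\ge 0$, $F_n=2^{2^n}+1$ denotes the $n$th Fermat number. *)

theory Defs
  imports "HOL-Number_Theory.Number_Theory"
begin

definition fermat_number :: "nat \<Rightarrow> nat" where
  "fermat_number n = 2 ^ (2 ^ n) + 1"

end

theory Submission
  imports Defs
begin

text \<open>
  Suppose that $3^{2^m} \equiv -1 \pmod N$ with $N = 2^{m+2} + 1$. Modulo each prime factor $p$ of
  $N$, the order of $3$ is then exactly $2^{m+1}$, so $p > 2^{m+1}$ and $N < 2p$: hence $N = p$ is
  prime. Now $3^{(N-1)/2} \equiv 1$, so $3$ is a quadratic residue modulo $N$ by Euler's criterion.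
  If $N$ is a Fermat number, this contradicts quadratic reciprocity, because $N \equiv 1 \pmod 4$
  and $N \equiv 2 \pmod 3$.
\<close>

text \<open>Squaring the hypothesis shows that the order divides \<open>2 ^ Suc m\<close>, so it is
  a power of two. If it already divided \<open>2 ^ m\<close>, then 1 and -1 would agree modulo
  \<open>p\<close>, which \<open>p > 2\<close> excludes.\<close>

lemma ord_eq_two_power:
  fixes p a m :: nat
  assumes "p > 2" and "[int a ^ (2 ^ m) = - 1] (mod int p)"
  shows "ord p a = 2 ^ Suc m"
proof -
  have "[(int a ^ (2 ^ m)) ^ 2 = (- 1) ^ 2] (mod int p)"
    using assms(2) by (rule cong_pow)
  then have "[int (a ^ (2 ^ Suc m)) = int 1] (mod int p)"
    by (simp add: power_mult [symmetric] mult.commute)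
  then have "ord p a dvd 2 ^ Suc m"
    by (simp only: cong_int_iff ord_divides)
  then obtain i where i: "i \<le> Suc m" "ord p a = 2 ^ i"
    using divides_primepow_nat[OF two_is_prime_nat] by blast
  have "\<not> i \<le> m"
  proof
    assume "i \<le> m"
    then have "[a ^ (2 ^ m) = 1] (mod p)"
      by (simp only: ord_divides i le_imp_power_dvd)
    then have "[int (a ^ (2 ^ m)) = int 1] (mod int p)"
      by (simp only: cong_int_iff)
    then have "[- 1 = 1] (mod int p)"
      using assms(2) by (metis cong_sym cong_trans of_nat_1 of_nat_power)
    then have "int p dvd 2"
      by (simp add: cong_iff_dvd_diff)
    then show False
      using assms(1) zdvd_imp_le by fastforce
  qed
  with i show ?thesis
    by (simp add: le_Suc_eq)
qed

lemma prime_two_power_plus_one: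
  fixes a m :: nat
  assumes cong: "[int a ^ (2 ^ m) = - 1] (mod int (2 ^ (m + 2) + 1))"
  shows "prime (2 ^ (m + 2) + 1 :: nat)"
proof -
  define N :: nat where "N = 2 ^ (m + 2) + 1"
  have "N \<noteq> 1" "odd N"
    by (simp_all add: N_def)
  then obtain p where p: "prime p" "p dvd N"
    using prime_factor_nat by blast
  with \<open>odd N\<close> have "p > 2"
    by (metis nat_less_le prime_ge_2_nat)
  have "[int a ^ (2 ^ m) = - 1] (mod int p)"
    using cong p(2) unfolding N_def [symmetric]
    by (rule cong_dvd_modulus[OF _ iffD2[OF of_nat_dvd_iff]])
  with \<open>p > 2\<close> have ord: "ord p a = 2 ^ Suc m"
    by (rule ord_eq_two_power)
  \<comment> \<open>\<open>ord p a\<close> is 0 by convention when \<open>p\<close> and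
    \<open>a\<close> are not coprime, so a nonzero order yields coprimality.\<close>
  then have "coprime p a"
    using ord_eq_0[of p a] by simp
  then have "2 ^ Suc m dvd p - 1"
    using order_divides_totient[of p a] ord p(1) by (simp add: totient_prime)
  then have "2 ^ Suc m \<le> p - 1"
    using \<open>p > 2\<close> by (intro dvd_imp_le) auto
  \<comment> \<open>From \<open>p \<ge> 2 ^ Suc m + 1\<close> follows
    \<open>2 * p \<ge> 2 ^ (m + 2) + 2 = N + 1\<close>. The cofactor of \<open>p\<close> in
    \<open>N\<close> must then be 1.\<close>
  then have "N < p * 2"
    using \<open>p > 2\<close> by (simp add: N_def)
  moreover obtain q where q: "N = p * q"
    using p(2) by blast
  ultimately have "q < 2"
    by simp
  moreover have "q \<noteq> 0"
    using q \<open>odd N\<close> by (metis even_zero mult_0_right)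
  ultimately have "N = p"
    using q by (simp add: less_2_cases_iff)
  with p(1) show ?thesis
    by (simp add: N_def)
qed

text \<open>As \<open>p\<close> is 1 modulo 4, the reciprocity sign is +1 and the symbol equals
  \<open>Legendre p 3\<close>; this is -1 because 2 is not a square modulo 3.\<close>

lemma Legendre_three:
  fixes p :: nat
  assumes p: "prime p" "p mod 4 = 1" "p mod 3 = 2"
  shows "Legendre 3 (int p) = - 1"
proof -
  have "p > 2"
    using p prime_ge_2_nat[of p] by (cases "p = 2") auto
  have "p \<noteq> 3"
    using p(3) by auto
  \<comment> \<open>For the modulus 3 the exponent in Euler's criterion is 1, so the symbol is
    congruent to \<open>p\<close> itself, hence to 2. Of the values 0, 1 and -1 only -1
    qualifies.\<close>
  have "[Legendre (int p) (int 3) = int p ^ ((3 - 1) div 2)] (mod int 3)"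
    by (rule euler_criterion) simp_all
  moreover have "int p mod 3 = 2"
    using p(3) by presburger
  ultimately have "Legendre (int p) 3 mod 3 = 2"
    by (simp add: cong_def)
  then have neg: "Legendre (int p) 3 = - 1"
    by (auto simp: Legendre_def split: if_splits)
  have "even ((p - 1) div 2)"
    using p(2) by presburger
  moreover have "Legendre (int 3) (int p) * Legendre (int p) (int 3)
      = (-1) ^ ((3 - 1) div 2 * ((p - 1) div 2))"
    by (rule Quadratic_Reciprocity) (use p \<open>p > 2\<close> \<open>p \<noteq> 3\<close> in auto)
  ultimately show ?thesis
    using neg by simp
qed

theorem corollary3:
  fixes n :: nat
  assumes "n \<ge> 5"
  shows "\<not> [(3::int) ^ ((fermat_number n - 1) div 4) = - 1] (mod int (fermat_number n))"
proof
  define N where "N = fermat_number n"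
  define k where "k = (2::nat) ^ (n - 1)"
  \<comment> \<open>This choice makes \<open>(N - 1) div 4\<close> equal to \<open>2 ^ m\<close>.
    Since \<open>k > 0\<close>, the subtraction does not truncate.\<close>
  define m where "m = 2 * k - 2"
  have k: "2 ^ n = 2 * k" "k > 0"
    using assms by (simp_all add: k_def flip: power_Suc)
  then have m: "2 ^ n = m + 2"
    by (simp add: m_def)
  have N: "N = 2 ^ (m + 2) + 1"
    by (simp only: N_def fermat_number_def m)
  \<comment> \<open>A power of 4 is 1 modulo 3, so this form gives the residue of \<open>N\<close>
    modulo 3.\<close>
  have N4: "N = 4 ^ k + 1"
    by (simp add: N_def fermat_number_def k power_mult)
  assume "[(3::int) ^ ((fermat_number n - 1) div 4) = - 1] (mod int (fermat_number n))"
  then have cong: "[3 ^ (2 ^ m) = - 1 :: int] (mod int N)"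
    by (fold N_def) (simp add: N)
  then have "prime N"
    using prime_two_power_plus_one[of 3 m] by (simp add: N)
  have "N mod 4 = 1"
    by (simp add: N mod_Suc)
  have "(4::nat) ^ k mod 3 = 1"
    using power_mod[of "4::nat" 3 k] by simp
  then have "N mod 3 = 2"
    by (simp add: N4 mod_Suc)
  have "N > 2"
    using \<open>N mod 4 = 1\<close> \<open>N mod 3 = 2\<close> by presburger
  have "[(3 ^ (2 ^ m)) ^ 2 = (- 1) ^ 2 :: int] (mod int N)"
    using cong by (rule cong_pow)
  moreover have "(N - 1) div 2 = 2 ^ m * 2"
    by (simp add: N)
  ultimately have "[3 ^ ((N - 1) div 2) = 1 :: int] (mod int N)"
    by (simp add: power_mult)
  \<comment> \<open>Euler's criterion equates the symbol, which is -1 by reciprocity, with a power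
    just shown to be 1.\<close>
  moreover have "[Legendre 3 (int N) = 3 ^ ((N - 1) div 2)] (mod int N)"
    using \<open>prime N\<close> \<open>N > 2\<close> by (rule euler_criterion)
  ultimately have "[- 1 = 1 :: int] (mod int N)"
    using Legendre_three[OF \<open>prime N\<close> \<open>N mod 4 = 1\<close> \<open>N mod 3 = 2\<close>] by (metis cong_trans)
  then have "int N dvd 2"
    by (simp add: cong_iff_dvd_diff)
  then show False
    using \<open>N > 2\<close> zdvd_imp_le by fastforce
qed

end
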